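(* Let $n\ge 1$ be an integer and let $a>\sqrt{2}$ be real. The logarithmic derivative $$\tilde{\rho}^*_{n}(a;x)=\frac{U_{n-1}(x)}{\int_a^xU_{n-1}(t)\,dt}=\frac{nU_{n-1}(x)}{T_{n}(x)-T_n(a)}$$ is least deviating from zero on $I=[-1;1]$ in the norm $\|\cdot\|^*$ among all logarithmic derivatives belonging to $\mathfrak{R}_n(a)$, i.e. $\tilde\rho_n^*(a;\cdot)\in\mathfrak{R}_n(a)$ and $\|\tilde{\rho}^*_{n}(a;\cdot)\|^*\le\|\rho\|^*$ for every $\rho\in\mathfrak{R}_n(a)$. Moreover, $$\|\tilde{\rho}^*_{n}(a;\cdot)\|^*=\frac{n}{\sqrt{T_n^2(a)-1}}.$$
   Context: A logarithmic derivative (l.d.) of degree $m\ge 1$ is a rational function $\rho(z)=P'(z)/P(z)=\sum_{k=1}^m \frac{1}{z-z_k}$, where $P(z)=\prod_{k=1}^m (z-z_k)$, $z_k\in\mathbb{C}$ (repetitions allowed); the l.d. of degree $0$ is $\rho\equiv 0$. Only real-valued l.d.s are considered, i.e. the multiset $\{z_k\}$ is symmetric with respect to the real line. For real $a$, $\mathfrak{R}_n(a)$ is the class of all real-valued l.d.s of degree less than or equal to $n$ that have the fixed pole $x=a$ (one of the $z_k$ equals $a$). Let $I:=[-1;1]$ and $\|\rho\|^*:=\max_{x\in I}|\sqrt{1-x^2}\,\rho(x)|$, understood as $+\infty$ if $\rho$ has a pole on $I$. $T_n(x)=\cos (n\arccos x)$ is the Chebyshev polynomial of the first kind and $U_n=\frac{1}{n+1}T_{n+1}'$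 is the Chebyshev polynomial of the second kind. *)

theory Defs
  imports "HOL-Complex_Analysis.Complex_Analysis" "HOL-Library.Multiset"
begin

text \<open>Rational functions are total functions on \<open>\<complex>\<close>. Writing a logarithmic derivative as the
  quotient \<open>P'/P\<close> makes it take the value \<open>0\<close> at each of its poles (\<open>x / 0 = 0\<close>), so two
  such quotients are equal as functions iff they are equal as rational functions.
  The degree is the size of the multiset; the empty multiset gives \<open>0\<close>.\<close>

definition root_poly :: "complex multiset \<Rightarrow> complex poly" where
  "root_poly Z = (\<Prod>w\<in>#Z. [:- w, 1:])"

definition log_deriv :: "complex multiset \<Rightarrow> complex \<Rightarrow> complex" where
  "log_deriv Z z = poly (pderiv (root_poly Z)) z / poly (root_poly Z) z"

lemma poly_root_poly_eq_0_iff: "poly (root_poly Z) z = 0 \<longleftrightarrow> z \<in># Z"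
  by (induction Z) (auto simp: root_poly_def)

lemma log_deriv_eq_sum:
  assumes "z \<notin># Z"
  shows "log_deriv Z z = (\<Sum>w\<in>#Z. 1 / (z - w))"
  using assms
proof (induction Z)
  case empty
  then show ?case by (simp add: log_deriv_def root_poly_def)
next
  case (add w Z)
  have nz: "z - w \<noteq> 0" "poly (root_poly Z) z \<noteq> 0"
    using add.prems by (auto simp: poly_root_poly_eq_0_iff)
  have 1: "root_poly (add_mset w Z) = [:- w, 1:] * root_poly Z"
    by (simp add: root_poly_def)
  have 2: "poly (root_poly (add_mset w Z)) z = (z - w) * poly (root_poly Z) z"
    unfolding 1 poly_mult by simp
  have 3: "poly (pderiv (root_poly (add_mset w Z))) z =
      (z - w) * poly (pderiv (root_poly Z)) z + poly (root_poly Z) z"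
    unfolding 1 pderiv_mult poly_add poly_mult by (simp add: pderiv_pCons)
  have "log_deriv (add_mset w Z) z = 1 / (z - w) + log_deriv Z z"
    unfolding log_deriv_def 2 3 using nz by (simp add: add_divide_distrib)
  then show ?case using add by simp
qed

definition real_log_derivs :: "nat \<Rightarrow> real \<Rightarrow> (complex \<Rightarrow> complex) set" where
  "real_log_derivs n a =
     {log_deriv Z | Z. image_mset cnj Z = Z \<and> size Z \<le> n \<and> complex_of_real a \<in># Z}"

text \<open>For a rational function without poles on \<open>[-1, 1]\<close> the supremum is a maximum.\<close>

definition star_norm :: "(complex \<Rightarrow> complex) \<Rightarrow> ereal" where
  "star_norm \<rho> =
     (if \<exists>x\<in>{-1..1}. is_pole \<rho> (complex_of_real x) then \<infinity>
      else (SUP x\<in>{-1..1}. ereal (cmod (complex_of_real (sqrt (1 - x\<^sup>2)) * \<rho> (complex_of_real x)))))"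

text \<open>The formula \<open>cos (n arccos x)\<close> determines the polynomial by its values on \<open>[-1, 1]\<close>.\<close>

definition Cheb_T :: "nat \<Rightarrow> real poly" where
  "Cheb_T n = (THE p. \<forall>x\<in>{-1..1}. poly p x = cos (real n * arccos x))"

lemma ex1_Cheb_T: "\<exists>!p. \<forall>x\<in>{-1..1}. poly p x = cos (real n * arccos x)"
proof (rule ex_ex1I)
  have "(\<exists>p. \<forall>x\<in>{-1..1}. poly p x = cos (real n * arccos x)) \<and>
        (\<exists>p. \<forall>x\<in>{-1..1}. poly p x = cos (real (Suc n) * arccos x))"
  proof (induction n)
    case 0
    show ?case
      by (intro conjI exI[of _ 1] exI[of _ "[:0, 1:]"]) (auto simp: cos_arccos)
  next
    case (Suc n)
    then obtain p q where p: "\<forall>x\<in>{-1..1}. poly p x = cos (real n * arccos x)"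
      and q: "\<forall>x\<in>{-1..1}. poly q x = cos (real (Suc n) * arccos x)" by blast
    have "poly ([:0, 2:] * q - p) x = cos (real (Suc (Suc n)) * arccos x)" if x: "x \<in> {-1..1}" for x
    proof -
      define t where "t = arccos x"
      have ct: "cos t = x" using x by (simp add: t_def cos_arccos)
      have "cos (real (Suc (Suc n)) * t) + cos (real n * t) = 2 * cos t * cos (real (Suc n) * t)"
        using cos_add[of "real (Suc n) * t" t] cos_diff[of "real (Suc n) * t" t]
        by (simp add: algebra_simps)
      then show ?thesis using p q x ct by (simp add: t_def)
    qed
    then show ?case using q by blast
  qed
  then show "\<exists>p. \<forall>x\<in>{-1..1}. poly p x = cos (real n * arccos x)" by blast
next
  fix p q :: "real poly"
  assume "\<forall>x\<in>{-1..1}. poly p x = cos (real n * arccos x)"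
    and "\<forall>x\<in>{-1..1}. poly q x = cos (real n * arccos x)"
  then have "{-1..1} \<subseteq> {x. poly (p - q) x = 0}" by auto
  moreover have "infinite {-1..1::real}" by simp
  ultimately have "infinite {x. poly (p - q) x = 0}" using finite_subset by blast
  then have "p - q = 0" using poly_roots_finite by blast
  then show "p = q" by simp
qed

lemma poly_Cheb_T: "x \<in> {-1..1} \<Longrightarrow> poly (Cheb_T n) x = cos (real n * arccos x)"
  using theI'[OF ex1_Cheb_T[of n]] by (simp add: Cheb_T_def)

definition Cheb_U :: "nat \<Rightarrow> real poly" where
  "Cheb_U n = smult (1 / real (n + 1)) (pderiv (Cheb_T (n + 1)))"

definition cpoly :: "real poly \<Rightarrow> complex \<Rightarrow> complex" where
  "cpoly p z = poly (map_poly complex_of_real p) z"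

definition rho_star :: "nat \<Rightarrow> real \<Rightarrow> complex \<Rightarrow> complex" where
  "rho_star n a z =
     cpoly (Cheb_U (n - 1)) z /
     contour_integral (linepath (complex_of_real a) z) (cpoly (Cheb_U (n - 1)))"

end

theory Submission
  imports Defs "HOL-Computational_Algebra.Fundamental_Theorem_Algebra"
begin

text \<open>Put \<open>A = T\<^sub>n(a)\<close> and \<open>D = T\<^sub>n - A\<close>. The function \<open>rho_star n a\<close> is \<open>D' / D\<close>, and with
  \<open>x = cos s\<close> its weighted modulus is \<open>n \<bar>sin (n s)\<bar> / (A - cos (n s))\<close>. The identity
  \<open>(A - C)\<^sup>2 - (A\<^sup>2 - 1) (1 - C\<^sup>2) = (A C - 1)\<^sup>2\<close> bounds this by \<open>n / sqrt (A\<^sup>2 - 1)\<close>, with equality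
  exactly where \<open>cos (n s) = 1 / A\<close>. There are \<open>n\<close> such points \<open>s\<close> in \<open>(0, \<pi>)\<close>, and the sign of \<open>sin (n s)\<close>
  alternates along them.

  For minimality, let \<open>P\<close> be a real polynomial of degree at most \<open>n\<close> with \<open>P(a) = 0\<close> whose logarithmic
  derivative has a smaller norm. Then \<open>P\<close> has no zero on \<open>[-1, 1]\<close>, and at the \<open>n\<close>
  points of equality the Wronskian \<open>N = D P' - D' P\<close> has the sign of \<open>- P\<close> times an alternating
  factor, so \<open>N\<close> has \<open>n - 1\<close> zeros in \<open>(-1, 1)\<close>. Both polynomials vanish at \<open>a\<close>: writing
  \<open>D = (x - a) Q\<close> and \<open>P = (x - a) R\<close> gives \<open>N = (x - a)\<^sup>2 (Q R' - Q' R)\<close>. The Wronskian of \<open>Q\<close>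
  and \<open>R\<close> has degree up to \<open>2 n - 4\<close>, so counting zeros does not suffice, and the position of the
  roots of \<open>Q\<close> enters. They lie on the ellipse with foci \<open>-1, 1\<close> through \<open>a\<close>, hence outside the open
  disc of radius \<open>r = sqrt (a\<^sup>2 - 1)\<close> about the origin (\<open>Cheb_T_level_outside\<close>), and \<open>r > 1\<close> is
  what the hypothesis \<open>a > sqrt 2\<close> amounts to.

  The core is \<open>wronskian_eq_0_of_zeros\<close>: if \<open>p\<close> and \<open>q\<close> have degree at most \<open>d\<close>, \<open>p\<close> is
  zero-free in an open disc about the origin, and their Wronskian has \<open>d\<close> zeros in an open interval
  that lies in the disc together with its upper endpoint, then the Wronskian vanishes identically. In other words,
  the derivatives of the functions \<open>q / p\<close> form a Chebyshev system on the interval. The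
  proof is by induction on \<open>d\<close> by Rolle's theorem, with \<open>p\<close> and \<open>q\<close> replaced by their polar derivatives
  with respect to the upper endpoint. This lowers the degree bound and the number of zeros by one
  each (\<open>wronskian_polar_deriv\<close>), and Laguerre's theorem (\<open>laguerre_polar_deriv\<close>) says that the
  polar derivative of \<open>p\<close> is again zero-free in the disc. With \<open>d = n - 1\<close> it follows that
  \<open>N = 0\<close>, against its sign at the points of equality.\<close>

section \<open>Real polynomials as complex functions\<close>

lemma cpoly_of_real [simp]: "cpoly p (of_real x) = of_real (poly p x)"
  unfolding cpoly_def by (induction p) (simp_all add: map_poly_pCons)

lemma cpoly_const [simp]: "cpoly [:c:] z = of_real c"
  by (cases "c = 0") (simp_all add: cpoly_def map_poly_pCons)

lemma cpoly_diff: "cpoly (p - q) z = cpoly p z - cpoly q z"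
proof -
  have "map_poly complex_of_real (p - q) = map_poly complex_of_real p - map_poly complex_of_real q"
    by (rule poly_eqI) (simp add: coeff_map_poly)
  then show ?thesis by (simp add: cpoly_def)
qed

lemma cpoly_mult: "cpoly (p * q) z = cpoly p z * cpoly q z"
proof -
  have "map_poly complex_of_real (p * q) = map_poly complex_of_real p * map_poly complex_of_real q"
    by (rule poly_eqI) (simp add: coeff_map_poly coeff_mult)
  then show ?thesis by (simp add: cpoly_def)
qed

lemma cpoly_smult: "cpoly (smult c p) z = of_real c * cpoly p z"
  using cpoly_mult[of "[:c:]" p z] by simp

lemma pderiv_cpoly:
  "map_poly complex_of_real (pderiv p) = pderiv (map_poly complex_of_real p)"
  by (rule poly_eqI) (simp add: coeff_map_poly coeff_pderiv)

lemma cpoly_pderiv: "cpoly (pderiv p) z = poly (pderiv (map_poly complex_of_real p)) z"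
  by (simp add: cpoly_def pderiv_cpoly)

lemma has_field_derivative_cpoly: "(cpoly p has_field_derivative cpoly (pderiv p) z) (at z)"
  unfolding cpoly_pderiv unfolding cpoly_def by (rule poly_DERIV)

section \<open>Logarithmic derivatives and multisets of roots\<close>

lemma smult_root_poly_proots: "smult (lead_coeff p) (root_poly (proots p)) = p"
  unfolding root_poly_def by (rule complex_poly_decompose_multiset)

lemma proots_root_poly: "proots (root_poly Z) = Z"
proof (induction Z)
  case empty
  then show ?case by (simp add: root_poly_def)
next
  case (add w Z)
  have "root_poly Z \<noteq> 0" by (auto simp: root_poly_def)
  moreover have "root_poly (add_mset w Z) = [:-w, 1:] * root_poly Z"
    by (simp add: root_poly_def)
  ultimately show ?case
    using add by (simp add: proots_mult del: mult_pCons_left)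
qed

lemma log_deriv_proots:
  "p \<noteq> 0 \<Longrightarrow> log_deriv (proots p) z = poly (pderiv p) z / poly p z"
  unfolding log_deriv_def
  by (subst (3 4) smult_root_poly_proots[symmetric]) (simp add: pderiv_smult)

text \<open>Conjugating coefficients conjugates roots. Together with \<open>proots_root_poly\<close> this matches
  conjugation-symmetric multisets with polynomials that have real coefficients, in both directions.\<close>

lemma map_poly_cnj_root_poly: "map_poly cnj (root_poly Z) = root_poly (image_mset cnj Z)"
proof -
  have "poly (map_poly cnj (root_poly Z)) x = poly (root_poly (image_mset cnj Z)) x" for x
    by (induction Z) (simp_all add: root_poly_def)
  then show ?thesis using poly_eq_poly_eq_iff by blast
qed

lemma real_root_poly:
  assumes "image_mset cnj Z = Z"
  obtains p :: "real poly" where "map_poly of_real p = root_poly Z"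
proof
  have "cnj (coeff (root_poly Z) i) = coeff (root_poly Z) i" for i
    using map_poly_cnj_root_poly[of Z] assms by (metis coeff_map_poly complex_cnj_zero)
  then have "complex_of_real (Re (coeff (root_poly Z) i)) = coeff (root_poly Z) i" for i
    by (simp add: complex_eq_iff)
  then show "map_poly of_real (map_poly Re (root_poly Z)) = root_poly Z"
    by (intro poly_eqI) (simp add: coeff_map_poly)
qed

lemma real_log_derivsI:
  fixes p :: "real poly"
  assumes p: "p \<noteq> 0" "degree p \<le> n" "poly p a = 0"
  shows "(\<lambda>z. cpoly (pderiv p) z / cpoly p z) \<in> real_log_derivs n a"
proof -
  define P where "P = map_poly complex_of_real p"
  define Z where "Z = proots P"
  have P0: "P \<noteq> 0" using p by (simp add: P_def map_poly_eq_0_iff)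
  have "map_poly cnj P = P"
    by (rule poly_eqI) (simp add: P_def coeff_map_poly)
  then have real: "coeff P i = cnj (coeff P i)" for i
    by (metis coeff_map_poly complex_cnj_zero)
  have "map_poly cnj (root_poly Z) = root_poly Z"
  proof (rule poly_eqI)
    fix i
    have "lead_coeff P * coeff (root_poly Z) j = coeff P j" for j
      using arg_cong[OF smult_root_poly_proots[of P], of "\<lambda>q. coeff q j"] by (simp add: Z_def)
    then have "lead_coeff P * cnj (coeff (root_poly Z) i) = lead_coeff P * coeff (root_poly Z) i"
      using real by (metis complex_cnj_mult)
    then show "coeff (map_poly cnj (root_poly Z)) i = coeff (root_poly Z) i"
      using P0 by (simp add: coeff_map_poly)
  qed
  then have "image_mset cnj Z = Z"
    by (metis map_poly_cnj_root_poly proots_root_poly)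
  moreover have "size Z \<le> n" using p by (simp add: Z_def size_proots_complex P_def degree_map_poly)
  moreover have "complex_of_real a \<in># Z"
    using P0 p(3) cpoly_of_real[of p a] by (simp add: Z_def P_def cpoly_def)
  moreover have "(\<lambda>z. cpoly (pderiv p) z / cpoly p z) = log_deriv Z"
    by (rule ext) (simp add: Z_def cpoly_pderiv log_deriv_proots[OF P0], simp add: P_def cpoly_def)
  ultimately show ?thesis by (auto simp: real_log_derivs_def)
qed

text \<open>Every element of \<open>Z\<close> is an actual pole, although the quotient takes the value \<open>0\<close> there:
  after cancelling a power of \<open>z - x\<close>, the numerator at \<open>x\<close> is the multiplicity of the root times a
  nonzero factor.\<close>

lemma is_pole_log_deriv:
  assumes "x \<in># Z"
  shows "is_pole (log_deriv Z) x"
proof -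
  define P where "P = root_poly Z"
  define k where "k = order x P"
  have P0: "P \<noteq> 0" by (auto simp: P_def root_poly_def)
  have Px: "poly P x = 0" using assms by (simp add: P_def poly_root_poly_eq_0_iff)
  then have k: "k \<noteq> 0" using P0 by (simp add: k_def order_root)
  then obtain j where j: "k = Suc j" using not0_implies_Suc by blast
  obtain q where q: "P = [:-x, 1:] ^ k * q" "\<not> [:-x, 1:] dvd q"
    using order_decomp[OF P0, of x] by (auto simp: k_def)
  then have qx: "poly q x \<noteq> 0" by (simp add: poly_eq_0_iff_dvd)
  define f where "f z = of_nat k * poly q z + (z - x) * poly (pderiv q) z" for z
  define g where "g z = (z - x) * poly q z" for z
  have eq: "f z / g z = log_deriv Z z" if "z \<noteq> x" for z
  proof -
    define e where "e = (z - x) ^ j"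
    have "poly ([:-x, 1:] ^ k) z = (z - x) ^ k" by simp
    then have pow: "poly ([:-x, 1:] ^ k) z = (z - x) * e" "poly (pderiv ([:-x, 1:] ^ k)) z = of_nat k * e"
      unfolding j pderiv_power_Suc by (simp_all only: e_def power_Suc) (simp add: pderiv_pCons)
    have "poly (pderiv P) z = e * f z" "poly P z = e * g z"
      unfolding q f_def g_def pderiv_mult poly_add poly_mult pow by (simp_all add: algebra_simps)
    moreover have "e \<noteq> 0" using that by (simp add: e_def)
    ultimately show ?thesis by (simp add: log_deriv_def P_def)
  qed
  have "is_pole (\<lambda>z. f z / g z) x"
  proof (rule is_pole_divide)
    show "isCont f x" unfolding f_def by (intro continuous_intros)
    show "f x \<noteq> 0" using k qx by (simp add: f_def)
    have "isCont (poly q) x" by (intro continuous_intros)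
    then have "\<forall>\<^sub>F z in at x. poly q z \<noteq> 0"
      using qx tendsto_imp_eventually_ne[of "poly q" "poly q x" "at x" 0] by (simp add: isCont_def)
    then have "\<forall>\<^sub>F z in at x. g z \<noteq> 0"
      using eventually_neq_at_within[of x x UNIV] by eventually_elim (simp add: g_def)
    moreover have "isCont g x" unfolding g_def by (intro continuous_intros)
    then have "g \<midarrow>x\<rightarrow> 0" by (simp add: isCont_def g_def)
    ultimately show "filterlim g (at 0) (at x)" by (simp add: filterlim_at)
  qed
  then show ?thesis
    by (rule is_pole_transform) (auto intro!: eventually_mono[OF eventually_neq_at_within] eq)
qed

section \<open>Polar derivatives and the theorem of Laguerre\<close>

text \<open>For \<open>degree p \<le> d\<close> this is Laguerre's polar derivative of \<open>p\<close>, taken as a form of degree \<open>d\<close>,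
  with respect to the point \<open>\<zeta>\<close>. It is the ordinary derivative with the point at infinity moved
  to \<open>\<zeta>\<close> by a Moebius map. The formal degree \<open>d\<close> is an argument of its own because the actual
  degree can be smaller, which counts as roots at infinity.\<close>

definition polar_deriv :: "'a::{comm_ring_1, semiring_no_zero_divisors} \<Rightarrow> nat \<Rightarrow> 'a poly \<Rightarrow> 'a poly" where
  "polar_deriv \<zeta> d p = smult (of_nat d) p + [:\<zeta>, -1:] * pderiv p"

lemma poly_polar_deriv:
  "poly (polar_deriv \<zeta> d p) x = of_nat d * poly p x + (\<zeta> - x) * poly (pderiv p) x"
  by (simp add: polar_deriv_def algebra_simps)

lemma cpoly_polar_deriv:
  "cpoly (polar_deriv \<zeta> d p) z = poly (polar_deriv (of_real \<zeta>) d (map_poly complex_of_real p)) z"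
proof -
  have "map_poly complex_of_real (polar_deriv \<zeta> d p)
      = polar_deriv (of_real \<zeta>) d (map_poly complex_of_real p)"
    by (rule poly_eqI)
       (simp add: polar_deriv_def coeff_map_poly coeff_pCons coeff_pderiv split: nat.split)
  then show ?thesis by (simp add: cpoly_def)
qed

lemma degree_polar_deriv_le:
  fixes p :: "'a::{comm_ring_1, semiring_no_zero_divisors} poly"
  assumes "degree p \<le> Suc d"
  shows "degree (polar_deriv \<zeta> (Suc d) p) \<le> d"
proof (rule degree_le, intro allI impI)
  fix i assume i: "i > d"
  have "i = Suc (i - 1)" using i by simp
  then obtain j where j: "i = Suc j" by blast
  have c: "coeff p (Suc i) = 0" using assms i by (intro coeff_eq_0) simp
  have "coeff (polar_deriv \<zeta> (Suc d) p) i = of_nat (Suc d) * coeff p i - of_nat i * coeff p i"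
    unfolding polar_deriv_def j using c j
    by (simp add: coeff_pderiv coeff_pCons)
  also have "\<dots> = 0"
  proof (cases "i = Suc d")
    case False
    then have "coeff p i = 0" using assms i by (intro coeff_eq_0) simp
    then show ?thesis by simp
  qed simp
  finally show "coeff (polar_deriv \<zeta> (Suc d) p) i = 0" .
qed

text \<open>For \<open>cmod x < r\<close> it says that \<open>w \<mapsto> (r\<^sup>2 - cnj x * w) / (x - w)\<close> maps the points with
  \<open>cmod w \<ge> r\<close> to the disc \<open>cmod u \<le> r\<close>, and those with \<open>cmod w < r\<close> to its complement.\<close>

lemma disc_identity:
  fixes x w :: complex and r :: real
  shows "(cmod (of_real (r\<^sup>2) - cnj x * w))\<^sup>2 - r\<^sup>2 * (cmod (x - w))\<^sup>2
         = (r\<^sup>2 - (cmod x)\<^sup>2) * (r\<^sup>2 - (cmod w)\<^sup>2)"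
  unfolding cmod_power2 by (simp add: power2_eq_square algebra_simps)

lemma norm_sum_mset_le:
  fixes f :: "'a \<Rightarrow> 'b::real_normed_vector"
  assumes "\<And>w. w \<in># Z \<Longrightarrow> norm (f w) \<le> r"
  shows "norm (\<Sum>w\<in>#Z. f w) \<le> real (size Z) * r"
  using assms
proof (induction Z)
  case (add w Z)
  have "norm (\<Sum>w\<in>#add_mset w Z. f w) \<le> norm (f w) + norm (\<Sum>w\<in>#Z. f w)"
    by (simp add: norm_triangle_ineq)
  also have "\<dots> \<le> r + real (size Z) * r" using add by (intro add_mono) auto
  finally show ?case by (simp add: algebra_simps)
qed simp

text \<open>Laguerre's theorem. Let \<open>\<phi>\<close> be the Moebius map of \<open>disc_identity\<close>. A zero of the polar
  derivative at \<open>x\<close> means that \<open>\<phi> \<zeta>\<close> is the average of the values of \<open>\<phi>\<close> at the roots of \<open>p\<close>,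
  including those at infinity, where \<open>\<phi>\<close> takes the value \<open>cnj x\<close>. These values lie in
  the closed disc of radius \<open>r\<close>, which is convex, while \<open>\<phi> \<zeta>\<close> lies outside it.\<close>

theorem laguerre_polar_deriv:
  fixes p :: "complex poly"
  assumes deg: "degree p \<le> Suc d" and \<zeta>: "cmod \<zeta> < r"
    and nz: "\<And>w. cmod w < r \<Longrightarrow> poly p w \<noteq> 0" and x: "cmod x < r"
  shows "poly (polar_deriv \<zeta> (Suc d) p) x \<noteq> 0"
proof
  assume 0: "poly (polar_deriv \<zeta> (Suc d) p) x = 0"
  define Z where "Z = proots p"
  define \<phi> where "\<phi> w = (of_real (r\<^sup>2) - cnj x * w) / (x - w)" for w
  \<comment> \<open>\<open>e\<close> is the number of roots of \<open>p\<close> at infinity.\<close>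
  define e where "e = Suc d - size Z"
  have r0: "r > 0" using x norm_ge_zero[of x] by linarith
  have px: "poly p x \<noteq> 0" using nz x by simp
  then have p0: "p \<noteq> 0" by auto
  have "size Z \<le> Suc d" using deg by (simp add: Z_def size_proots_complex)
  then have e: "size Z + e = Suc d" by (simp add: e_def)
  have ne: "x \<noteq> \<zeta>"
    using 0 px by (auto simp: poly_polar_deriv simp del: of_nat_Suc)
  have xZ: "x \<notin># Z" using px p0 by (simp add: Z_def)
  define s where "s = (\<Sum>w\<in>#Z. 1 / (x - w))"
  have "poly (pderiv p) x / poly p x = s"
    using log_deriv_proots[OF p0, of x] log_deriv_eq_sum[OF xZ] by (simp add: Z_def s_def)
  then have "poly (pderiv p) x = s * poly p x"
    using px by (auto simp: divide_eq_eq)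
  with 0 have "(of_nat (Suc d) + (\<zeta> - x) * s) * poly p x = 0"
    by (simp add: poly_polar_deriv algebra_simps del: of_nat_Suc)
  then have s: "of_nat (Suc d) + (\<zeta> - x) * s = 0"
    using px by (metis mult_eq_0_iff)
  define K where "K = complex_of_real (r\<^sup>2) - x * cnj x"
  have \<phi>_alt: "\<phi> w = K * (1 / (x - w)) + cnj x" if "w \<noteq> x" for w
    using that by (simp add: \<phi>_def K_def field_simps)
  have sum: "(\<Sum>w\<in>#Y. \<phi> w) = K * (\<Sum>w\<in>#Y. 1 / (x - w)) + of_nat (size Y) * cnj x"
    if "x \<notin># Y" for Y
    using that
  proof (induction Y)
    case (add w Y)
    then have "\<phi> w = K * (1 / (x - w)) + cnj x" by (intro \<phi>_alt) auto
    with add show ?case by (simp add: algebra_simps)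
  qed simp
  have "(\<Sum>w\<in>#Z. \<phi> w) + of_nat e * cnj x = K * s + of_nat (size Z + e) * cnj x"
    using sum[OF xZ] by (simp add: s_def algebra_simps)
  also have "\<dots> = of_nat (Suc d) * \<phi> \<zeta>"
  proof -
    have "s = of_nat (Suc d) * (1 / (x - \<zeta>))"
      using s ne by (simp add: field_simps del: of_nat_Suc)
    then show ?thesis using \<phi>_alt[of \<zeta>] ne e by (simp add: algebra_simps del: of_nat_Suc)
  qed
  finally have "real (Suc d) * cmod (\<phi> \<zeta>) = cmod ((\<Sum>w\<in>#Z. \<phi> w) + of_nat e * cnj x)"
    by (metis norm_mult norm_of_nat)
  also have "\<dots> \<le> real (size Z) * r + real e * r"
  proof (intro norm_triangle_le add_mono norm_sum_mset_le)
    fix w assume w: "w \<in># Z"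
    then have "poly p w = 0" using p0 by (simp add: Z_def)
    then have wr: "cmod w \<ge> r" using nz[of w] by fastforce
    have "(r\<^sup>2 - (cmod x)\<^sup>2) * (r\<^sup>2 - (cmod w)\<^sup>2) \<le> 0"
      using wr x r0 by (intro mult_nonneg_nonpos) (simp_all add: power_mono)
    then have "(cmod (of_real (r\<^sup>2) - cnj x * w))\<^sup>2 \<le> (r * cmod (x - w))\<^sup>2"
      using disc_identity[of r x w] by (simp add: power_mult_distrib)
    then have "cmod (of_real (r\<^sup>2) - cnj x * w) \<le> r * cmod (x - w)"
      by (rule power2_le_imp_le) (use r0 in simp)
    moreover have "x \<noteq> w" using w xZ by auto
    ultimately show "cmod (\<phi> w) \<le> r"
      by (simp add: \<phi>_def norm_divide divide_le_eq)
  next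
    show "cmod (of_nat e * cnj x) \<le> real e * r"
      using x by (simp add: norm_mult mult_left_mono)
  qed
  also have "\<dots> = real (Suc d) * r" using e by (metis distrib_right of_nat_add)
  finally have "cmod (\<phi> \<zeta>) \<le> r" by (simp del: of_nat_Suc)
  then have "(cmod (of_real (r\<^sup>2) - cnj x * \<zeta>))\<^sup>2 \<le> (r * cmod (x - \<zeta>))\<^sup>2"
    using ne by (intro power_mono) (auto simp: \<phi>_def norm_divide divide_le_eq)
  then have "(r\<^sup>2 - (cmod x)\<^sup>2) * (r\<^sup>2 - (cmod \<zeta>)\<^sup>2) \<le> 0"
    using disc_identity[of r x \<zeta>] by (simp add: power_mult_distrib)
  moreover have "(r\<^sup>2 - (cmod x)\<^sup>2) * (r\<^sup>2 - (cmod \<zeta>)\<^sup>2) > 0"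
    using x \<zeta> r0 by (intro mult_pos_pos) (auto intro!: power_strict_mono)
  ultimately show False by simp
qed

section \<open>Zeros of Wronskians\<close>

definition wronskian :: "'a::idom poly \<Rightarrow> 'a poly \<Rightarrow> 'a poly" where
  "wronskian p q = p * pderiv q - pderiv p * q"

lemma wronskian_mult_left:
  "wronskian (h * p) (h * q) = h\<^sup>2 * wronskian p q"
  by (simp add: wronskian_def pderiv_mult power2_eq_square algebra_simps)

text \<open>This is the reason why polar derivatives interact with Rolle's theorem. Dividing both sides by
  \<open>(\<zeta> - x) ^ Suc d * (poly p1 x)\<^sup>2\<close>, the right-hand side becomes the derivative of the quotient of
  \<open>wronskian p q\<close> by \<open>(\<zeta> - x) ^ d * p1\<close>. So, where neither \<open>p\<close>, \<open>p1\<close> nor \<open>\<zeta> - x\<close> has a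
  zero, the critical points of that quotient are the zeros of \<open>wronskian p1 q1\<close>.\<close>

lemma wronskian_polar_deriv:
  fixes p q :: "real poly" and \<zeta> :: real and d :: nat
  defines "p1 \<equiv> polar_deriv \<zeta> (Suc d) p" and "q1 \<equiv> polar_deriv \<zeta> (Suc d) q"
  shows "poly p x * poly (wronskian p1 q1) x =
     real d * poly (wronskian p q) x * poly p1 x +
     (\<zeta> - x) * (poly (pderiv (wronskian p q)) x * poly p1 x - poly (wronskian p q) x * poly (pderiv p1) x)"
proof -
  have 1: "poly (pderiv (polar_deriv \<zeta> (Suc d) f)) x
      = real d * poly (pderiv f) x + (\<zeta> - x) * poly (pderiv (pderiv f)) x" for f
    by (simp add: polar_deriv_def pderiv_add pderiv_mult pderiv_smult pderiv_pCons pderiv_minus algebra_simps)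
  show ?thesis
    unfolding p1_def q1_def wronskian_def poly_diff poly_mult pderiv_diff pderiv_mult poly_add 1
      poly_polar_deriv
    by (simp add: algebra_simps)
qed

text \<open>Induction on \<open>d\<close>. The quotient \<open>g\<close> has the \<open>Suc d\<close> given zeros, so by Rolle's theorem its
  derivative has \<open>d\<close> zeros between them, and these are zeros of the Wronskian of the polar derivatives,
  which is \<open>0\<close> by the induction hypothesis. Hence \<open>g\<close> is constant, and it has a zero.\<close>

theorem wronskian_eq_0_of_zeros:
  fixes p q :: "real poly" and y :: "nat \<Rightarrow> real"
  assumes "degree p \<le> d" and "degree q \<le> d"
    and "\<And>w. cmod w < r \<Longrightarrow> cpoly p w \<noteq> 0"
    and r: "-r \<le> u" "v < r"
    and "\<And>i. i < d \<Longrightarrow> y i \<in> {u<..<v}"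
    and "\<And>i. i < d \<Longrightarrow> poly (wronskian p q) (y i) = 0"
    and "\<And>i. Suc i < d \<Longrightarrow> y i < y (Suc i)"
  shows "wronskian p q = 0"
  using assms(1-3,6-8)
proof (induction d arbitrary: p q y)
  case 0
  then have "pderiv p = 0" "pderiv q = 0" by (simp_all add: pderiv_eq_0_iff)
  then show ?case by (simp add: wronskian_def)
next
  case (Suc d)
  define p1 where "p1 = polar_deriv v (Suc d) p"
  define q1 where "q1 = polar_deriv v (Suc d) q"
  define W where "W = wronskian p q"
  define g where "g x = (1 / (v - x)) ^ d * poly W x / poly p1 x" for x
  have uv: "u < v" using Suc.prems(4)[of 0] by simp
  have p1_nz: "cpoly p1 w \<noteq> 0" if "cmod w < r" for w
    unfolding p1_def cpoly_polar_deriv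
  proof (rule laguerre_polar_deriv[OF _ _ _ that])
    show "degree (map_poly complex_of_real p) \<le> Suc d" using Suc.prems(1) by (simp add: degree_map_poly)
    show "cmod (of_real v) < r" using r uv by simp
    show "\<And>w. cmod w < r \<Longrightarrow> poly (map_poly complex_of_real p) w \<noteq> 0"
      using Suc.prems(3) by (simp add: cpoly_def)
  qed
  have nz: "poly p x \<noteq> 0" "poly p1 x \<noteq> 0" if "x \<in> {u<..<v}" for x
  proof -
    have "cmod (of_real x) < r" using that r by auto
    from Suc.prems(3)[OF this] p1_nz[OF this] show "poly p x \<noteq> 0" "poly p1 x \<noteq> 0" by simp_all
  qed
  have g': "(g has_real_derivative
      (1 / (v - x)) ^ Suc d * poly p x * poly (wronskian p1 q1) x / (poly p1 x)\<^sup>2) (at x)"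
    if x: "x \<in> {u<..<v}" for x
  proof -
    define h where "h = 1 / (v - x)"
    have vx: "v - x \<noteq> 0" using x by auto
    have h': "((\<lambda>x. 1 / (v - x)) has_real_derivative h\<^sup>2) (at x)"
      unfolding h_def using vx by (auto intro!: derivative_eq_intros simp: power2_eq_square)
    \<comment> \<open>For \<open>d = 0\<close> the truncated exponent is harmless because of the factor \<open>real d\<close>.\<close>
    have hd: "real d * h ^ (d - 1) * h\<^sup>2 = real d * h ^ Suc d"
      by (cases d) (simp_all add: power2_eq_square)
    have hd': "((\<lambda>x. (1 / (v - x)) ^ d) has_real_derivative real d * h ^ Suc d) (at x)"
      using DERIV_power[OF h', of d] hd by (simp add: h_def mult_ac)
    have "(g has_real_derivative
       ((real d * h ^ Suc d * poly W x + h ^ d * poly (pderiv W) x) * poly p1 x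
        - h ^ d * poly W x * poly (pderiv p1) x) / (poly p1 x * poly p1 x)) (at x)"
      unfolding g_def
      by (rule DERIV_cong[OF DERIV_divide[OF DERIV_mult[OF hd' poly_DERIV] poly_DERIV nz(2)[OF x]]])
         (simp add: h_def algebra_simps)
    also have "(real d * h ^ Suc d * poly W x + h ^ d * poly (pderiv W) x) * poly p1 x
        - h ^ d * poly W x * poly (pderiv p1) x
      = h ^ Suc d * (real d * poly W x * poly p1 x +
         (v - x) * (poly (pderiv W) x * poly p1 x - poly W x * poly (pderiv p1) x))"
    proof -
      have "h ^ d = h ^ Suc d * (v - x)" using vx by (simp add: h_def)
      then show ?thesis by (simp only:) (simp only: algebra_simps)
    qed
    also have "\<dots> = h ^ Suc d * (poly p x * poly (wronskian p1 q1) x)"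
      unfolding W_def p1_def q1_def wronskian_polar_deriv ..
    finally show ?thesis by (simp only: h_def mult.assoc power2_eq_square)
  qed
  have "\<exists>z. y i < z \<and> z < y (Suc i) \<and> poly (wronskian p1 q1) z = 0" if i: "i < d" for i
  proof -
    have I: "{y i..y (Suc i)} \<subseteq> {u<..<v}"
      using Suc.prems(4)[of i] Suc.prems(4)[of "Suc i"] i by auto
    have "\<exists>z. y i < z \<and> z < y (Suc i) \<and>
      (\<lambda>t. (1 / (v - z)) ^ Suc d * poly p z * poly (wronskian p1 q1) z / (poly p1 z)\<^sup>2 * t) = (\<lambda>t. 0)"
    proof (rule Rolle_deriv)
      show "y i < y (Suc i)" using Suc.prems(6) i by simp
      show "g (y i) = g (y (Suc i))" using Suc.prems(5) i by (simp add: g_def W_def)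
      show "continuous_on {y i..y (Suc i)} g"
        by (intro continuous_at_imp_continuous_on ballI DERIV_isCont[OF g']) (use I in blast)
      fix x assume "y i < x" "x < y (Suc i)"
      then have "x \<in> {y i..y (Suc i)}" by simp
      then have "x \<in> {u<..<v}" using I by blast
      from g'[OF this] show "(g has_derivative
        (*) ((1 / (v - x)) ^ Suc d * poly p x * poly (wronskian p1 q1) x / (poly p1 x)\<^sup>2)) (at x)"
        by (simp add: has_field_derivative_def)
    qed
    then obtain z where z: "y i < z" "z < y (Suc i)"
      and eq: "(\<lambda>t. (1 / (v - z)) ^ Suc d * poly p z * poly (wronskian p1 q1) z / (poly p1 z)\<^sup>2 * t) = (\<lambda>t. 0)"
      by blast
    have "z \<in> {y i..y (Suc i)}" using z by simp
    then have "z \<in> {u<..<v}" using I by blast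
    with nz[of z] fun_cong[OF eq, of 1] z show ?thesis by auto
  qed
  then obtain z where z: "\<And>i. i < d \<Longrightarrow> y i < z i \<and> z i < y (Suc i) \<and> poly (wronskian p1 q1) (z i) = 0"
    by metis
  have W1: "wronskian p1 q1 = 0"
  proof (rule Suc.IH[of p1 q1 z])
    show "degree p1 \<le> d" "degree q1 \<le> d"
      using Suc.prems(1,2) by (auto simp: p1_def q1_def intro!: degree_polar_deriv_le)
    show "z i \<in> {u<..<v}" if "i < d" for i
      using z[OF that] Suc.prems(4)[of i] Suc.prems(4)[of "Suc i"] that by auto
    show "z i < z (Suc i)" if "Suc i < d" for i
      using z[of i] z[of "Suc i"] that by auto
  qed (use z p1_nz in auto)
  have "poly W x = 0" if x: "x \<in> {u<..<v}" for x
  proof -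
    have "\<exists>c. \<forall>x\<in>{u<..<v}. g x = c"
    proof (rule has_field_derivative_zero_constant)
      fix x assume "x \<in> {u<..<v}"
      from g'[OF this] show "(g has_field_derivative 0) (at x within {u<..<v})"
        unfolding W1 by (simp add: has_field_derivative_at_within)
    qed simp
    then have "g x = g (y 0)" using x Suc.prems(4)[of 0] by auto
    then show ?thesis using Suc.prems(5)[of 0] nz(2)[OF x] x by (auto simp: g_def W_def)
  qed
  then have "{u<..<v} \<subseteq> {x. poly W x = 0}" by auto
  then have "infinite {x. poly W x = 0}" using uv infinite_Ioo finite_subset by blast
  then show ?case using poly_roots_finite W_def by blast
qed

section \<open>Chebyshev polynomials\<close>

lemma Cheb_T_eqI:
  assumes "\<And>x. x \<in> {-1..1} \<Longrightarrow> poly p x = cos (real n * arccos x)"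
  shows "Cheb_T n = p"
  unfolding Cheb_T_def by (rule the1_equality[OF ex1_Cheb_T]) (use assms in blast)

lemma Cheb_T_0: "Cheb_T 0 = 1"
  by (rule Cheb_T_eqI) simp

lemma Cheb_T_1: "Cheb_T (Suc 0) = [:0, 1:]"
  by (rule Cheb_T_eqI) (simp add: cos_arccos)

lemma Cheb_T_rec: "Cheb_T (Suc (Suc n)) = [:0, 2:] * Cheb_T (Suc n) - Cheb_T n"
proof (rule Cheb_T_eqI)
  fix x :: real assume x: "x \<in> {-1..1}"
  define t where "t = arccos x"
  have ct: "cos t = x" using x by (simp add: t_def cos_arccos)
  have "cos (real (Suc (Suc n)) * t) + cos (real n * t) = 2 * cos t * cos (real (Suc n) * t)"
    using cos_add[of "real (Suc n) * t" t] cos_diff[of "real (Suc n) * t" t]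
    by (simp add: algebra_simps)
  then show "poly ([:0, 2:] * Cheb_T (Suc n) - Cheb_T n) x = cos (real (Suc (Suc n)) * arccos x)"
    using x ct by (simp add: poly_Cheb_T t_def)
qed

lemma degree_Cheb_T_le: "degree (Cheb_T n) \<le> n"
proof (induction n rule: less_induct)
  case (less n)
  consider "n = 0" | "n = Suc 0" | m where "n = Suc (Suc m)"
    by (metis not0_implies_Suc)
  then show ?case
  proof cases
    case 3
    have "degree ([:0, 2:] * Cheb_T (Suc m)) \<le> Suc (degree (Cheb_T (Suc m)))"
      using degree_mult_le[of "[:0, 2:]" "Cheb_T (Suc m)"] by simp
    then show ?thesis
      using less[of m] less[of "Suc m"] 3 unfolding 3 Cheb_T_rec
      by (intro degree_diff_le) auto
  qed (simp_all add: Cheb_T_0 Cheb_T_1)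
qed

lemma cpoly_Cheb_T_cos: "cpoly (Cheb_T n) (cos w) = cos (of_nat n * w)"
proof (induction n rule: less_induct)
  case (less n)
  consider "n = 0" | "n = Suc 0" | m where "n = Suc (Suc m)"
    by (metis not0_implies_Suc)
  then show ?case
  proof cases
    case 3
    have "cos (of_nat n * w) + cos (of_nat m * w) = 2 * cos w * cos (of_nat (Suc m) * w)"
      using cos_add[of "of_nat (Suc m) * w" w] cos_diff[of "of_nat (Suc m) * w" w]
      by (simp add: 3 algebra_simps)
    moreover have "cpoly (Cheb_T n) (cos w) = 2 * cos w * cos (of_nat (Suc m) * w) - cos (of_nat m * w)"
    proof -
      have "cpoly [:0, 2:] (cos w) = 2 * cos w"
        by (simp add: cpoly_def map_poly_pCons)
      moreover have "cpoly (Cheb_T m) (cos w) = cos (of_nat m * w)"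
        "cpoly (Cheb_T (Suc m)) (cos w) = cos (of_nat (Suc m) * w)"
        using less[of m] less[of "Suc m"] 3 by simp_all
      ultimately show ?thesis unfolding 3 Cheb_T_rec cpoly_diff cpoly_mult by (simp only:)
    qed
    ultimately show ?thesis by (metis add_diff_cancel_right')
  qed (simp_all add: Cheb_T_0 Cheb_T_1 cpoly_def map_poly_pCons)
qed

lemma poly_Cheb_T_cos: "poly (Cheb_T n) (cos t) = cos (real n * t)"
proof -
  have "complex_of_real (poly (Cheb_T n) (cos t)) = of_real (cos (real n * t))"
  proof -
    have "of_nat n * complex_of_real t = of_real (real n * t)" by simp
    then show ?thesis
      using cpoly_Cheb_T_cos[of n "of_real t"] by (simp only: cos_of_real cpoly_of_real)
  qed
  then show ?thesis by (simp only: of_real_eq_iff)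
qed

lemma poly_Cheb_T_cosh: "poly (Cheb_T n) (cosh s) = cosh (real n * s)"
proof -
  have cosh: "cos (\<i> * complex_of_real x) = complex_of_real (cosh x)" for x
    by (simp add: cos_i_times cosh_field_def exp_minus flip: exp_of_real)
  have "complex_of_real (poly (Cheb_T n) (cosh s)) = of_real (cosh (real n * s))"
  proof -
    have "of_nat n * (\<i> * complex_of_real s) = \<i> * of_real (real n * s)" by simp
    then show ?thesis
      using cpoly_Cheb_T_cos[of n "\<i> * of_real s"] cosh by (simp only: cpoly_of_real)
  qed
  then show ?thesis by (simp only: of_real_eq_iff)
qed

lemma poly_Cheb_T_gt_1:
  assumes "n \<ge> 1" "a > 1"
  shows "poly (Cheb_T n) a > 1"
proof -
  have "poly (Cheb_T n) a = cosh (real n * arcosh a)"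
    using poly_Cheb_T_cosh[of n "arcosh a"] assms by simp
  moreover have "real n * arcosh a \<noteq> 0" using assms by simp
  ultimately show ?thesis
    using cosh_real_ge_1[of "real n * arcosh a"] cosh_real_one_iff[of "real n * arcosh a"] by linarith
qed

text \<open>The level set \<open>T\<^sub>n(z) = T\<^sub>n(a)\<close> lies on the ellipse with foci \<open>-1, 1\<close> through \<open>a\<close>, whose
  minor semi-axis is \<open>sqrt (a\<^sup>2 - 1)\<close>. To see this, put \<open>z = cos (u + \<i> v)\<close> and \<open>a = cosh s\<close>. Then
  \<open>cos (n u) * cosh (n v) = cosh (n s)\<close> and \<open>sin (n u) * sinh (n v) = 0\<close>, which for \<open>n s > 0\<close>
  forces \<open>\<bar>v\<bar> = s\<close>.\<close>

lemma Cheb_T_level_outside: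
  assumes n: "n \<ge> 1" and a: "a > 1"
    and z: "cpoly (Cheb_T n) z = of_real (poly (Cheb_T n) a)"
  shows "(cmod z)\<^sup>2 \<ge> a\<^sup>2 - 1"
proof -
  define w where "w = Arccos z"
  define u where "u = Re w"
  define v where "v = Im w"
  define s where "s = arcosh a"
  have zw: "z = cos w" by (simp add: w_def)
  have Re_cos': "Re (cos x) = cos (Re x) * cosh (Im x)" for x
    by (simp add: Re_cos cosh_field_def)
  have Im_cos': "Im (cos x) = - sin (Re x) * sinh (Im x)" for x
    by (simp add: Im_cos sinh_field_def algebra_simps diff_divide_distrib)
  have s: "s > 0" "cosh s = a" using a by (simp_all add: s_def)
  have "cos (of_nat n * w) = of_real (cosh (real n * s))"
    using z cpoly_Cheb_T_cos[of n w] poly_Cheb_T_cosh[of n s] s zw by simp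
  then have re: "cos (real n * u) * cosh (real n * v) = cosh (real n * s)"
    and im: "sin (real n * u) * sinh (real n * v) = 0"
    using Re_cos'[of "of_nat n * w"] Im_cos'[of "of_nat n * w"] by (simp_all add: u_def v_def)
  have big: "cosh (real n * s) > 1"
    using poly_Cheb_T_gt_1[OF n a] poly_Cheb_T_cosh[of n s] s by simp
  have "v \<noteq> 0"
  proof
    assume "v = 0"
    with re big cos_le_one[of "real n * u"] show False by simp
  qed
  then have "sin (real n * u) = 0" using im n by simp
  then have "\<bar>cos (real n * u)\<bar> = 1" by (simp add: sin_zero_abs_cos_one)
  then have "cosh (real n * v) = cosh (real n * s)"
    using arg_cong[OF re, of abs] by (simp add: abs_mult)
  then have "cosh (real n * \<bar>v\<bar>) = cosh (real n * s)"
    by (cases "v \<ge> 0") simp_all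
  then have "\<bar>v\<bar> = s"
    using s n cosh_real_nonneg_less_iff[of "real n * \<bar>v\<bar>" "real n * s"]
      cosh_real_nonneg_less_iff[of "real n * s" "real n * \<bar>v\<bar>"] by auto
  then have v: "cosh v = a" using s by (metis abs_if cosh_minus)
  have "(cmod z)\<^sup>2 = (cos u)\<^sup>2 * a\<^sup>2 + (sin u)\<^sup>2 * (sinh v)\<^sup>2"
    unfolding cmod_power2 zw Re_cos' Im_cos' by (simp add: v power_mult_distrib flip: u_def v_def)
  also have "\<dots> = a\<^sup>2 - (sin u)\<^sup>2"
    using v by (simp add: sinh_square_eq cos_squared_eq algebra_simps)
  finally have "(cmod z)\<^sup>2 = a\<^sup>2 - (sin u)\<^sup>2" .
  moreover have "(sin u)\<^sup>2 \<le> 1" by (simp add: abs_square_le_1)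
  ultimately show ?thesis by linarith
qed

lemma poly_pderiv_Cheb_T_cos:
  "poly (pderiv (Cheb_T n)) (cos t) * sin t = real n * sin (real n * t)"
proof -
  have "((\<lambda>t. poly (Cheb_T n) (cos t)) has_real_derivative poly (pderiv (Cheb_T n)) (cos t) * - sin t) (at t)"
    by (rule DERIV_chain2[OF poly_DERIV]) (auto intro!: derivative_eq_intros)
  moreover have "((\<lambda>t. cos (real n * t)) has_real_derivative - sin (real n * t) * real n) (at t)"
    by (auto intro!: derivative_eq_intros)
  ultimately have "poly (pderiv (Cheb_T n)) (cos t) * - sin t = - sin (real n * t) * real n"
    unfolding poly_Cheb_T_cos using DERIV_unique by blast
  then show ?thesis by (simp add: mult_ac)
qed

lemma pderiv_Cheb_T:
  assumes "n \<ge> 1"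
  shows "pderiv (Cheb_T n) = smult (real n) (Cheb_U (n - 1))"
  using assms by (simp add: Cheb_U_def)

section \<open>The extremal logarithmic derivative and its norm\<close>

text \<open>\<open>T\<^sub>n / n\<close> is a primitive of \<open>U\<^bsub>n-1\<^esub>\<close>.\<close>

lemma rho_star_eq:
  assumes n: "n \<ge> 1"
  shows "rho_star n a z = of_nat n * cpoly (Cheb_U (n - 1)) z /
            (cpoly (Cheb_T n) z - cpoly (Cheb_T n) (complex_of_real a))"
proof -
  have n0: "of_nat n \<noteq> (0::complex)" using n by simp
  have "(cpoly (Cheb_U (n - 1)) has_contour_integral
      cpoly (Cheb_T n) (pathfinish (linepath (of_real a) z)) / of_nat n -
      cpoly (Cheb_T n) (pathstart (linepath (of_real a) z)) / of_nat n) (linepath (of_real a) z)"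
  proof (rule contour_integral_primitive)
    fix x
    have "cpoly (pderiv (Cheb_T n)) x / of_nat n = cpoly (Cheb_U (n - 1)) x"
      using n0 by (simp add: pderiv_Cheb_T[OF n] cpoly_smult)
    then show "((\<lambda>x. cpoly (Cheb_T n) x / of_nat n) has_field_derivative cpoly (Cheb_U (n - 1)) x) (at x within UNIV)"
      using DERIV_cdivide[OF has_field_derivative_cpoly[of "Cheb_T n" x], of "of_nat n"] by simp
  qed auto
  then have "contour_integral (linepath (of_real a) z) (cpoly (Cheb_U (n - 1)))
     = (cpoly (Cheb_T n) z - cpoly (Cheb_T n) (of_real a)) / of_nat n"
    by (simp add: contour_integral_unique diff_divide_distrib)
  then show ?thesis using n0 by (simp add: rho_star_def)
qed

definition Cheb_diff :: "nat \<Rightarrow> real \<Rightarrow> real poly" where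
  "Cheb_diff n a = Cheb_T n - [:poly (Cheb_T n) a:]"

lemma poly_Cheb_diff: "poly (Cheb_diff n a) x = poly (Cheb_T n) x - poly (Cheb_T n) a"
  by (simp add: Cheb_diff_def)

lemma cpoly_Cheb_diff: "cpoly (Cheb_diff n a) z = cpoly (Cheb_T n) z - of_real (poly (Cheb_T n) a)"
  by (simp add: Cheb_diff_def cpoly_diff)

lemma pderiv_Cheb_diff [simp]: "pderiv (Cheb_diff n a) = pderiv (Cheb_T n)"
  by (simp add: Cheb_diff_def pderiv_diff)

lemma degree_Cheb_diff_le: "degree (Cheb_diff n a) \<le> n"
  unfolding Cheb_diff_def by (intro degree_diff_le degree_Cheb_T_le) simp

lemma rho_star_eq_quotient:
  assumes "n \<ge> 1"
  shows "rho_star n a z = cpoly (pderiv (Cheb_diff n a)) z / cpoly (Cheb_diff n a) z"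
  using rho_star_eq[OF assms, of a z]
  by (simp add: cpoly_Cheb_diff pderiv_Cheb_T[OF assms] cpoly_smult)

text \<open>For \<open>A > 1\<close> and \<open>k < n\<close> these are the angles \<open>t\<close> in \<open>(0, \<pi>)\<close> with \<open>cos (n t) = 1 / A\<close>, in increasing
  order: \<open>n t\<close> lies between \<open>k \<pi>\<close> and \<open>(k + 1) \<pi>\<close>.\<close>

definition equioscillation_angle :: "nat \<Rightarrow> real \<Rightarrow> nat \<Rightarrow> real" where
  "equioscillation_angle n A k = (real k * pi + (if even k then arccos (1 / A) else pi - arccos (1 / A))) / real n"

lemma equioscillation_angle_properties:
  assumes n: "n \<ge> 1" and A: "A > 1" and k: "k < n"
  shows "equioscillation_angle n A k \<in> {0<..<pi}"
    and "cos (real n * equioscillation_angle n A k) = 1 / A"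
    and "sin (real n * equioscillation_angle n A k) = (-1) ^ k * (sqrt (A\<^sup>2 - 1) / A)"
    and "equioscillation_angle n A k < equioscillation_angle n A (Suc k)"
proof -
  define \<alpha> where "\<alpha> = arccos (1 / A)"
  have inv: "0 < 1 / A" "1 / A < 1" using A by auto
  have \<alpha>: "0 < \<alpha>" "\<alpha> < pi"
    using inv arccos_lt_bounded[of "1 / A"] by (simp_all only: \<alpha>_def)
  have cos\<alpha>: "cos \<alpha> = 1 / A"
    unfolding \<alpha>_def using inv by (intro cos_arccos) linarith+
  have sin\<alpha>: "sin \<alpha> = sqrt (A\<^sup>2 - 1) / A"
  proof -
    have "sin \<alpha> = sqrt (1 - (1 / A)\<^sup>2)" 
      unfolding \<alpha>_def using inv by (intro sin_arccos) linarith+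
    also have "1 - (1 / A)\<^sup>2 = (A\<^sup>2 - 1) / A\<^sup>2" using A by (simp add: field_simps power2_eq_square)
    finally show ?thesis using A by (simp add: real_sqrt_divide)
  qed
  define b where "b j = (if even j then \<alpha> else pi - \<alpha>)" for j :: nat
  have b: "0 < b j" "b j < pi" for j using \<alpha> by (auto simp: b_def)
  have na: "real n * equioscillation_angle n A j = real j * pi + b j" for j
    using n by (simp add: equioscillation_angle_def b_def \<alpha>_def)
  have "real n * 0 < real n * equioscillation_angle n A k" unfolding na using b[of k] by (simp add: add_nonneg_pos)
  moreover have "real n * equioscillation_angle n A k < real n * pi"
  proof -
    have "real k * pi + pi \<le> real n * pi"
      using k mult_right_mono[of "real (Suc k)" "real n" pi] by (simp add: algebra_simps)
    then show ?thesis unfolding na using b[of k] by linarith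
  qed
  ultimately show "equioscillation_angle n A k \<in> {0<..<pi}"
    using n by (simp only: mult_less_cancel_left_pos) auto
  show "cos (real n * equioscillation_angle n A k) = 1 / A"
    unfolding na by (auto simp: b_def cos_add sin_diff cos_diff cos\<alpha>)
  show "sin (real n * equioscillation_angle n A k) = (-1) ^ k * (sqrt (A\<^sup>2 - 1) / A)"
    unfolding na by (auto simp: b_def sin_add sin_diff cos_diff sin\<alpha>)
  have "real n * equioscillation_angle n A k < real n * equioscillation_angle n A (Suc k)"
    unfolding na using b[of k] b[of "Suc k"] by (simp add: algebra_simps)
  then show "equioscillation_angle n A k < equioscillation_angle n A (Suc k)" using n by simp
qed

text \<open>With \<open>C = cos (n s)\<close> and \<open>S = sin (n s)\<close>, the bound is
  \<open>(A\<^sup>2 - 1) S\<^sup>2 = (A - C)\<^sup>2 - (A C - 1)\<^sup>2 \<le> (A - C)\<^sup>2\<close>, with equality for \<open>C = 1 / A\<close>.\<close>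

lemma star_norm_rho_star:
  assumes n: "n \<ge> 1" and a: "a > 1"
  shows "star_norm (rho_star n a) = ereal (real n / sqrt ((poly (Cheb_T n) a)\<^sup>2 - 1))"
proof -
  define A where "A = poly (Cheb_T n) a"
  define c where "c = sqrt (A\<^sup>2 - 1)"
  define D where "D = Cheb_diff n a"
  define F where "F x = cmod (complex_of_real (sqrt (1 - x\<^sup>2)) * rho_star n a (complex_of_real x))" for x :: real
  have A: "A > 1" unfolding A_def by (rule poly_Cheb_T_gt_1[OF n a])
  have A2: "A\<^sup>2 > 1" using A by (simp add: one_less_power)
  have c: "c > 0" "c\<^sup>2 = A\<^sup>2 - 1" using A2 by (auto simp: c_def)
  have D_cos: "poly D (cos s) = cos (real n * s) - A" for s
    by (simp add: D_def poly_Cheb_diff poly_Cheb_T_cos A_def)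
  have D_neg: "A - cos s > 0" for s using A cos_le_one[of s] by linarith
  have F: "F (cos s) = real n * \<bar>sin (real n * s)\<bar> / (A - cos (real n * s))" if s: "s \<in> {0..pi}" for s
  proof -
    have s0: "sin s \<ge> 0" using s by (auto intro: sin_ge_zero)
    then have "sqrt (1 - (cos s)\<^sup>2) = sin s" by (simp flip: sin_squared_eq)
    then have "F (cos s) = \<bar>poly (pderiv D) (cos s) * sin s\<bar> / \<bar>poly D (cos s)\<bar>"
      using s0 by (simp add: F_def rho_star_eq_quotient[OF n] norm_mult norm_divide abs_mult mult.commute flip: D_def)
    also have "poly (pderiv D) (cos s) * sin s = real n * sin (real n * s)"
      by (simp add: D_def poly_pderiv_Cheb_T_cos)
    also have "\<bar>poly D (cos s)\<bar> = A - cos (real n * s)"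
      using D_neg[of "real n * s"] by (simp add: D_cos)
    finally show ?thesis by (simp add: abs_mult)
  qed
  have no_pole: "\<not> is_pole (rho_star n a) (of_real x)" if x: "x \<in> {-1..1}" for x
  proof
    assume "is_pole (rho_star n a) (of_real x)"
    have "poly D x \<noteq> 0"
      using D_cos[of "arccos x"] D_neg[of "real n * arccos x"] x by (simp add: cos_arccos)
    then have "cpoly D (of_real x) \<noteq> 0" by simp
    moreover have "isCont (cpoly p) z" for p z
      using has_field_derivative_cpoly DERIV_isCont by blast
    ultimately have "isCont (\<lambda>z. cpoly (pderiv D) z / cpoly D z) (of_real x)"
      by (intro isCont_divide)
    moreover have "rho_star n a = (\<lambda>z. cpoly (pderiv D) z / cpoly D z)"
      unfolding D_def by (rule ext) (rule rho_star_eq_quotient[OF n])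
    ultimately have "isCont (rho_star n a) (of_real x)" by simp
    with \<open>is_pole (rho_star n a) (of_real x)\<close> show False
      using not_tendsto_and_filterlim_at_infinity[of "at (of_real x)" "rho_star n a"]
      by (auto simp: is_pole_def isCont_def)
  qed
  have le: "F x \<le> real n / c" if x: "x \<in> {-1..1}" for x
  proof -
    define s where "s = arccos x"
    define C where "C = cos (real n * s)"
    define S where "S = sin (real n * s)"
    have s: "s \<in> {0..pi}" "cos s = x" using x by (simp_all add: s_def arccos_lbound arccos_ubound cos_arccos)
    have "(c * S)\<^sup>2 = (A\<^sup>2 - 1) * (1 - C\<^sup>2)"
      by (simp add: power_mult_distrib c S_def C_def sin_squared_eq)
    also have "\<dots> = (A - C)\<^sup>2 - (A * C - 1)\<^sup>2"
      by (simp add: power2_eq_square algebra_simps)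
    finally have "(c * \<bar>S\<bar>)\<^sup>2 \<le> (A - C)\<^sup>2" by (simp add: power_mult_distrib)
    then have "c * \<bar>S\<bar> \<le> A - C"
      by (rule power2_le_imp_le) (use D_neg[of "real n * s"] in \<open>simp add: C_def\<close>)
    then have "\<bar>S\<bar> / (A - C) \<le> 1 / c"
      using c D_neg[of "real n * s"] by (simp add: C_def divide_le_eq le_divide_eq mult.commute)
    then have "real n * (\<bar>S\<bar> / (A - C)) \<le> real n * (1 / c)" by (rule mult_left_mono) simp
    then show ?thesis using F[OF s(1)] by (simp add: s S_def C_def)
  qed
  define s0 where "s0 = equioscillation_angle n A 0"
  have "s0 \<in> {0<..<pi}" "cos (real n * s0) = 1 / A" "sin (real n * s0) = c / A"
    using equioscillation_angle_properties[OF n A, of 0] n by (simp_all add: s0_def c_def)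
  then have attained: "F (cos s0) = real n / c"
  proof -
    assume s0: "s0 \<in> {0<..<pi}" "cos (real n * s0) = 1 / A" "sin (real n * s0) = c / A"
    have "A - 1 / A = c\<^sup>2 / A" using A c(2) by (simp add: field_simps power2_eq_square)
    then show ?thesis
      using F[of s0] s0 c A by (simp add: power2_eq_square)
  qed
  have "(SUP x\<in>{-1..1}. ereal (F x)) = ereal (real n / c)"
  proof (rule antisym)
    show "(SUP x\<in>{-1..1}. ereal (F x)) \<le> ereal (real n / c)"
      using le by (intro SUP_least) simp
    show "ereal (real n / c) \<le> (SUP x\<in>{-1..1}. ereal (F x))"
      using attained by (intro SUP_upper2[of "cos s0"]) simp_all
  qed
  then show ?thesis
    using no_pole by (simp add: star_norm_def F_def c_def A_def)
qed

section \<open>The lower bound\<close>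

lemma degree_cofactor_le:
  fixes p :: "'a::idom poly"
  assumes "degree ([:-a, 1:] * p) \<le> n"
  shows "degree p \<le> n - 1"
proof (cases "p = 0")
  case False
  then have "degree ([:-a, 1:] * p) = 1 + degree p"
    by (subst degree_mult_eq) auto
  then show ?thesis using assms by simp
qed simp

text \<open>The lower bound, stated for real polynomials and with denominators cleared. A strict bound below the extremal
  norm fixes the sign of the Wronskian \<open>N\<close> of \<open>D\<close> and \<open>P\<close> at the \<open>n\<close> equioscillation
  points, and the resulting \<open>n - 1\<close> zeros of \<open>N\<close> are one too many for \<open>wronskian_eq_0_of_zeros\<close>
  once the common factor \<open>x - a\<close> is removed.\<close>

theorem no_poly_below_extremal_bound:
  fixes P :: "real poly"
  assumes n: "n \<ge> 1" and a: "a > sqrt 2"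
    and deg: "degree P \<le> n" and Pa: "poly P a = 0"
    and P_nz: "\<And>x. x \<in> {-1..1} \<Longrightarrow> poly P x \<noteq> 0"
    and bound: "\<And>x. x \<in> {-1..1} \<Longrightarrow>
      sqrt ((poly (Cheb_T n) a)\<^sup>2 - 1) * (sqrt (1 - x\<^sup>2) * \<bar>poly (pderiv P) x\<bar>) < real n * \<bar>poly P x\<bar>"
  shows False
proof -
  have a1: "a > 1" "a\<^sup>2 > 2" "a > 0"
  proof -
    show "a > 0" using a real_sqrt_ge_zero[of 2] by linarith
    have "(sqrt 2)\<^sup>2 < a\<^sup>2" using a by (intro power_strict_mono) auto
    then show "a\<^sup>2 > 2" by simp
    have "1 < sqrt (2::real)" by simp
    then show "a > 1" using a by linarith
  qed
  define A where "A = poly (Cheb_T n) a"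
  define c where "c = sqrt (A\<^sup>2 - 1)"
  define D where "D = Cheb_diff n a"
  define N where "N = wronskian D P"
  define t where "t = equioscillation_angle n A"
  define x where "x k = cos (t k)" for k
  have A: "A > 1" unfolding A_def by (rule poly_Cheb_T_gt_1[OF n a1(1)])
  have A2: "A\<^sup>2 > 1" using A by (simp add: one_less_power)
  have c: "c > 0" "c\<^sup>2 = A\<^sup>2 - 1" using A2 by (auto simp: c_def)
  note t = equioscillation_angle_properties[OF n A, folded t_def]
  \<comment> \<open>At \<open>x k\<close> the term \<open>D' P\<close> of \<open>N\<close> outweighs \<open>D P'\<close>: that is the strict bound, since
    \<open>D' / D\<close> attains the extremal norm there with sign \<open>(-1) ^ Suc k\<close>.\<close>
  have N_sign: "poly N (x k) * ((-1) ^ k * poly P (x k)) < 0" if k: "k < n" for k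
  proof -
    let ?s = "sin (t k)" and ?p = "poly P (x k)" and ?p' = "poly (pderiv P) (x k)"
    have s: "?s > 0" using t(1)[OF k] by (simp add: sin_gt_zero)
    have xI: "x k \<in> {-1..1}" by (simp add: x_def)
    have Dx: "poly D (x k) = - (c\<^sup>2 / A)"
      using A t(2)[OF k] by (simp add: D_def x_def poly_Cheb_diff poly_Cheb_T_cos c flip: A_def)
         (simp add: field_simps power2_eq_square)
    define e where "e = (-1) ^ k * ?p"
    have D'x: "poly (pderiv D) (x k) * ?s = real n * ((-1) ^ k * (c / A))"
      using poly_pderiv_Cheb_T_cos[of n "t k"] t(3)[OF k] by (simp add: D_def x_def c_def)
    have "poly N (x k) * ?s = - (c\<^sup>2 / A) * ?p' * ?s - (poly (pderiv D) (x k) * ?s) * ?p"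
      by (simp add: N_def wronskian_def Dx algebra_simps)
    also have "\<dots> = - (c / A) * (c * (?s * ?p') + real n * e)"
      unfolding D'x e_def by (simp add: algebra_simps add_divide_distrib power2_eq_square)
    finally have Ns: "poly N (x k) * ?s = - (c / A) * (c * (?s * ?p') + real n * e)" .
    have "poly N (x k) * e * ?s = (poly N (x k) * ?s) * e" by simp
    also have "\<dots> = - (c / A) * (c * (?s * ?p') * e + real n * e\<^sup>2)"
      unfolding Ns by (simp only: power2_eq_square distrib_left distrib_right mult_ac)
    finally have "poly N (x k) * e * ?s = \<dots>" .
    moreover have "c * (?s * ?p') * e + real n * e\<^sup>2 > 0"
    proof -
      have sq: "sqrt (1 - (x k)\<^sup>2) = ?s"
        using s by (simp add: x_def flip: sin_squared_eq)
      have e: "\<bar>e\<bar> = \<bar>?p\<bar>" by (simp add: e_def abs_mult power_abs)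
      have "\<bar>c * (?s * ?p') * e\<bar> = (c * (?s * \<bar>?p'\<bar>)) * \<bar>?p\<bar>"
        using c s by (simp add: abs_mult e)
      also have "\<dots> < (real n * \<bar>?p\<bar>) * \<bar>?p\<bar>"
        using bound[OF xI] P_nz[OF xI] unfolding sq by (intro mult_strict_right_mono) (auto simp: c_def A_def)
      also have "\<dots> = real n * e\<^sup>2"
        by (simp add: power2_eq_square flip: e)
      finally show ?thesis by linarith
    qed
    ultimately have "poly N (x k) * e * ?s < 0"
      using c A by (simp add: mult_neg_pos)
    then show ?thesis using s by (simp add: mult_less_0_iff e_def)
  qed
  have P_same: "poly P u * poly P v > 0" if uv: "u \<in> {-1..1}" "v \<in> {-1..1}" "u < v" for u v
  proof (rule ccontr)
    assume "\<not> poly P u * poly P v > 0"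
    then have "poly P u * poly P v < 0"
      using P_nz[OF uv(1)] P_nz[OF uv(2)] by (metis mult_eq_0_iff not_less_iff_gr_or_eq)
    then obtain z where "u < z" "z < v" "poly P z = 0" using poly_IVT[OF uv(3)] by blast
    then show False using P_nz[of z] uv by simp
  qed
  \<comment> \<open>The cosine decreases, so the order is reversed to make the points increase.\<close>
  define X where "X i = x (n - 1 - i)" for i
  have "\<exists>y. X i < y \<and> y < X (Suc i) \<and> poly N y = 0" if i: "i < n - 1" for i
  proof -
    define k where "k = n - 1 - Suc i"
    have k: "k < n" "Suc k < n" "n - 1 - i = Suc k" using i unfolding k_def by linarith+
    have lt: "x (Suc k) < x k"
      unfolding x_def using t(1)[OF k(1)] t(1)[OF k(2)] t(4)[OF k(1)] by (intro cos_monotone_0_pi) auto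
    moreover have "poly N (x (Suc k)) * poly N (x k) < 0"
    proof -
      have "(poly N (x (Suc k)) * ((-1) ^ Suc k * poly P (x (Suc k)))) * (poly N (x k) * ((-1) ^ k * poly P (x k))) > 0"
        using N_sign[OF k(1)] N_sign[OF k(2)] by (rule mult_neg_neg[rotated])
      then have "(poly N (x (Suc k)) * poly N (x k)) * (poly P (x (Suc k)) * poly P (x k)) < 0"
        by (simp add: mult_ac flip: power_mult_distrib)
      moreover have "poly P (x (Suc k)) * poly P (x k) > 0"
        by (intro P_same lt) (simp_all add: x_def)
      ultimately show ?thesis by (metis mult_less_0_iff order_less_asym)
    qed
    ultimately show ?thesis
      using poly_IVT[of "x (Suc k)" "x k" N] k by (auto simp: X_def k_def)
  qed
  then obtain y where y: "\<And>i. i < n - 1 \<Longrightarrow> X i < y i \<and> y i < X (Suc i) \<and> poly N (y i) = 0"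
    by metis
  have "poly D a = 0" by (simp add: D_def poly_Cheb_diff)
  then obtain Q where Q: "D = [:-a, 1:] * Q" by (auto simp: poly_eq_0_iff_dvd dvd_def)
  obtain R where R: "P = [:-a, 1:] * R" using Pa by (auto simp: poly_eq_0_iff_dvd dvd_def)
  have N_fact: "N = [:-a, 1:]\<^sup>2 * wronskian Q R"
    unfolding N_def Q R by (rule wronskian_mult_left)
  have X1: "X i \<in> {-1..1}" for i by (simp add: X_def x_def)
  have "wronskian Q R = 0"
  proof (rule wronskian_eq_0_of_zeros[where d = "n - 1" and r = "sqrt (a\<^sup>2 - 1)" and u = "-1" and v = 1 and y = y])
    show "degree Q \<le> n - 1"
      using degree_Cheb_diff_le[of n a] by (intro degree_cofactor_le[of a]) (simp only: D_def flip: Q)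
    show "degree R \<le> n - 1"
      using deg by (intro degree_cofactor_le[of a]) (simp only: flip: R)
    show "cpoly Q w \<noteq> 0" if w: "cmod w < sqrt (a\<^sup>2 - 1)" for w
    proof
      assume "cpoly Q w = 0"
      then have "cpoly D w = 0" by (simp add: Q cpoly_mult del: mult_pCons_left)
      then have "(cmod w)\<^sup>2 \<ge> a\<^sup>2 - 1"
        using Cheb_T_level_outside[OF n a1(1), of w] by (simp add: D_def cpoly_Cheb_diff)
      then have "sqrt (a\<^sup>2 - 1) \<le> cmod w" by (intro real_le_lsqrt) simp_all
      then show False using w by simp
    qed
    show "- sqrt (a\<^sup>2 - 1) \<le> - 1" "1 < sqrt (a\<^sup>2 - 1)" using a1 by simp_all
    show "y i \<in> {-1<..<1}" if "i < n - 1" for i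
      using y[of i] X1[of i] X1[of "Suc i"] that by auto
    show "poly (wronskian Q R) (y i) = 0" if i: "i < n - 1" for i
    proof -
      have "y i \<noteq> a" using y[of i] X1[of "Suc i"] i a1 by auto
      moreover have "poly N (y i) = 0" using y[of i] i by auto
      ultimately show ?thesis unfolding N_fact by simp
    qed
    show "y i < y (Suc i)" if "Suc i < n - 1" for i
      using y[of i] y[of "Suc i"] that by auto
  qed
  then have "poly N (x 0) = 0" by (simp add: N_fact)
  with N_sign[of 0] n show False by simp
qed

lemma extremal_bound_le_star_norm:
  assumes n: "n \<ge> 1" and a: "a > sqrt 2" and \<rho>: "\<rho> \<in> real_log_derivs n a"
  shows "ereal (real n / sqrt ((poly (Cheb_T n) a)\<^sup>2 - 1)) \<le> star_norm \<rho>"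
proof (rule ccontr)
  define c where "c = sqrt ((poly (Cheb_T n) a)\<^sup>2 - 1)"
  assume "\<not> ereal (real n / sqrt ((poly (Cheb_T n) a)\<^sup>2 - 1)) \<le> star_norm \<rho>"
  then have less: "star_norm \<rho> < ereal (real n / c)" by (simp add: c_def)
  obtain Z where Z: "\<rho> = log_deriv Z" "image_mset cnj Z = Z" "size Z \<le> n" "of_real a \<in># Z"
    using \<rho> by (auto simp: real_log_derivs_def)
  obtain P :: "real poly" where P: "map_poly of_real P = root_poly Z"
    using real_root_poly[OF Z(2)] .
  have P_root: "poly P x = 0 \<longleftrightarrow> of_real x \<in># Z" for x
    using cpoly_of_real[of P x] poly_root_poly_eq_0_iff[of Z "of_real x"] by (simp add: cpoly_def P)
  have no_pole: "\<not> is_pole \<rho> (of_real x)" if "x \<in> {-1..1}" for x :: real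
    using less that by (auto simp: star_norm_def split: if_splits)
  then have P_nz: "poly P x \<noteq> 0" if "x \<in> {-1..1}" for x
    using is_pole_log_deriv that by (auto simp: P_root Z(1))
  have "1 < sqrt (2::real)" by simp
  then have "a > 1" using a by linarith
  then have "(poly (Cheb_T n) a)\<^sup>2 > 1" using poly_Cheb_T_gt_1[OF n] by (simp add: one_less_power)
  then have c: "c > 0" by (simp add: c_def)
  show False
  proof (rule no_poly_below_extremal_bound[OF n a _ _ P_nz])
    have "degree P = degree (root_poly Z)" by (simp add: degree_map_poly flip: P)
    also have "\<dots> = size Z" by (metis proots_root_poly size_proots_complex)
    finally show "degree P \<le> n" using Z(3) by simp
    show "poly P a = 0" using Z(4) by (simp add: P_root)
    fix x :: real assume x: "x \<in> {-1..1}"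
    have "\<rho> (of_real x) = of_real (poly (pderiv P) x / poly P x)"
      using cpoly_of_real[of P x] cpoly_of_real[of "pderiv P" x]
      by (simp add: Z(1) log_deriv_def cpoly_def pderiv_cpoly flip: P)
    then have "cmod (of_real (sqrt (1 - x\<^sup>2)) * \<rho> (of_real x)) = sqrt (1 - x\<^sup>2) * \<bar>poly (pderiv P) x\<bar> / \<bar>poly P x\<bar>"
      using x by (simp add: norm_mult norm_divide abs_square_le_1 abs_le_iff)
    moreover have "ereal (cmod (of_real (sqrt (1 - x\<^sup>2)) * \<rho> (of_real x))) \<le> star_norm \<rho>"
      using no_pole x by (auto simp: star_norm_def intro!: SUP_upper)
    ultimately have "sqrt (1 - x\<^sup>2) * \<bar>poly (pderiv P) x\<bar> / \<bar>poly P x\<bar> < real n / c"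
      using less by (metis ereal_less_le less_ereal.simps(1) order_le_less_trans)
    then show "sqrt ((poly (Cheb_T n) a)\<^sup>2 - 1) * (sqrt (1 - x\<^sup>2) * \<bar>poly (pderiv P) x\<bar>) < real n * \<bar>poly P x\<bar>"
      using c P_nz[OF x] by (simp add: field_simps flip: c_def)
  qed
qed

section \<open>Minimality of the extremal logarithmic derivative\<close>

theorem theorem1:
  fixes n :: nat and a :: real
  assumes "n \<ge> 1" and "a > sqrt 2"
  shows "(\<forall>z. rho_star n a z =
            of_nat n * cpoly (Cheb_U (n - 1)) z /
            (cpoly (Cheb_T n) z - cpoly (Cheb_T n) (complex_of_real a))) \<and>
         rho_star n a \<in> real_log_derivs n a \<and>
         (\<forall>\<rho>\<in>real_log_derivs n a. star_norm (rho_star n a) \<le> star_norm \<rho>) \<and>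
         star_norm (rho_star n a) = ereal (real n / sqrt ((poly (Cheb_T n) a)\<^sup>2 - 1))"
proof -
  have "1 < sqrt (2::real)" by simp
  then have a: "a > 1" using assms(2) by linarith
  have "Cheb_diff n a \<noteq> 0"
  proof
    assume "Cheb_diff n a = 0"
    then have "poly (Cheb_T n) 1 = poly (Cheb_T n) a" using poly_Cheb_diff[of n a 1] by simp
    then show False using poly_Cheb_T_gt_1[OF assms(1) a] poly_Cheb_T_cos[of n 0] by simp
  qed
  then have "(\<lambda>z. cpoly (pderiv (Cheb_diff n a)) z / cpoly (Cheb_diff n a) z) \<in> real_log_derivs n a"
    by (intro real_log_derivsI degree_Cheb_diff_le) (simp_all add: poly_Cheb_diff)
  then have "rho_star n a \<in> real_log_derivs n a"
    using rho_star_eq_quotient[OF assms(1), of a] by presburger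
  then show ?thesis
    using rho_star_eq[OF assms(1)] star_norm_rho_star[OF assms(1) a] extremal_bound_le_star_norm[OF assms]
    by auto
qed

end
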